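(* Let $X=X_\sigma$ be an affine toric variety with cone $\sigma$, let $p$ be the primitive vector on a ray $\rho$ of $\sigma$, let $e_1,e_2$ be Demazure roots of $X_\sigma$ corresponding to $p$, and endow $X$ with the monoid structure of corank one given by the comultiplication $$\chi^u\mapsto\chi^u\otimes\chi^u\,(1\otimes\chi^{e_1}+\chi^{e_2}\otimes1)^{\langle p,u\rangle},\qquad u\in S_\sigma.$$ Then the center $Z(X)$ is $$Z(X)=\begin{cases}\overline{O_\rho}\cap\{\chi^{u+e_1}=\chi^{u+e_2}\ \ \forall u\in S_\sigma:\ \langle p,u\rangle=1\}&\text{if }e_1\ne e_2;\\ X&\text{if }e_1=e_2.\end{cases}$$
   Context: The ground field $\mathbb K$ is algebraically closed of characteristic zero. $N$ is a lattice of rank $n$, $N_{\mathbb Q}=N\otimes_{\mathbb Z}\mathbb Q$, $M=\mathrm{Hom}(N,\mathbb Z)$, $M_{\mathbb Q}=M\otimes_{\mathbb Z}\mathbb Q$, with pairing $\langle\cdot,\cdot\rangle$. For a strongly convex polyhedral cone $\sigma\subseteq N_{\mathbb Q}$: $\sigma^\vee=\{u\in M_{\mathbb Q}\mid\langle v,u\rangle\ge0\ \forall v\in\sigma\}$, $S_\sigma=M\cap\sigma^\vee$, $X_\sigma=\mathrm{Spec}\bigoplus_{u\in S_\sigma}\mathbb K\chi^u$ with $\chi^u\chi^{u'}=\chi^{u+u'}$. A ray is a one-dimensional face. If $p_1,\dots,p_m$ are the primitive lattice vectors on the rays of $\sigma$, a Demazure root corresponding to $p_i$ is $e\in M$ with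 $\langle p_i,e\rangle=-1$ and $\langle p_j,e\rangle\ge0$ for $j\ne i$. The comultiplication is dual to the multiplication $(x,y)\mapsto x*y$; explicitly, $\chi^u(x*y)=\sum_{i+j=\langle p,u\rangle}\binom{\langle p,u\rangle}{i}\chi^{u+ie_2}(x)\chi^{u+je_1}(y)$. (This is an associative multiplication with unity, whose group of invertible elements has a maximal torus of codimension one.) Points of $X_\sigma$ correspond to semigroup homomorphisms $S_\sigma\to(\mathbb K,\cdot)$ (with $0\mapsto1$), $x\mapsto(u\mapsto\chi^u(x))$. $O_\rho$ is the orbit of the torus $\mathrm{Hom}(M,\mathbb K^\times)$ corresponding to the face $\rho$: the set of $x\in X_\sigma$ with $\chi^u(x)\ne0$ for $u\in S_\sigma$, $\langle p,u\rangle=0$, and $\chi^u(x)=0$ for $u\in S_\sigma$, $\langle p,u\rangle\ne0$; $\overline{O_\rho}$ is its closure in $X$. The center is $Z(X)=\{x\in X\mid x*y=y*x\ \forall y\in X\}$. *)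

theory Defs
  imports
    "HOL-Analysis.Analysis"
    "HOL-Library.Poly_Mapping"
    "HOL-Library.FuncSet"
    "HOL-Computational_Algebra.Polynomial"
begin

text \<open>
  A lattice basis identifies \<open>N\<close> with \<open>int ^ 'n\<close> and the dual basis identifies
  \<open>M = Hom(N, Z)\<close> with \<open>int ^ 'n\<close>; accordingly \<open>N\<^sub>Q\<close> and \<open>M\<^sub>Q\<close> are \<open>rat ^ 'n\<close>, the rank is
  \<open>CARD('n)\<close>, and the pairing of \<open>N\<close> and \<open>M\<close> (or of \<open>N\<^sub>Q\<close> and \<open>M\<^sub>Q\<close>) is \<open>scalar_product\<close>.
\<close>

definition rat_vec :: "int ^ 'n \<Rightarrow> rat ^ 'n" where
  "rat_vec v = (\<chi> i. of_int (v $ i))"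


subsection \<open>Cones\<close>

definition cone_generated_by :: "(rat ^ 'n) set \<Rightarrow> (rat ^ 'n) set" where
  "cone_generated_by G = {\<Sum>g\<in>G. c g *s g | c. \<forall>g\<in>G. 0 \<le> c g}"

definition polyhedral_cone :: "(rat ^ 'n) set \<Rightarrow> bool" where
  "polyhedral_cone \<sigma> \<longleftrightarrow> (\<exists>G. finite G \<and> \<sigma> = cone_generated_by G)"

definition strongly_convex_polyhedral_cone :: "(rat ^ 'n) set \<Rightarrow> bool" where
  "strongly_convex_polyhedral_cone \<sigma> \<longleftrightarrow> polyhedral_cone \<sigma> \<and> \<sigma> \<inter> uminus ` \<sigma> = {0}"

definition dual_cone :: "(rat ^ 'n) set \<Rightarrow> (rat ^ 'n) set" where
  "dual_cone \<sigma> = {u. \<forall>v\<in>\<sigma>. 0 \<le> scalar_product v u}"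

definition face_of_cone :: "(rat ^ 'n) set \<Rightarrow> (rat ^ 'n) set \<Rightarrow> bool" where
  "face_of_cone \<tau> \<sigma> \<longleftrightarrow> (\<exists>u\<in>dual_cone \<sigma>. \<tau> = {v \<in> \<sigma>. scalar_product v u = 0})"

definition ray_of_cone :: "(rat ^ 'n) set \<Rightarrow> (rat ^ 'n) set \<Rightarrow> bool" where
  "ray_of_cone \<rho> \<sigma> \<longleftrightarrow> face_of_cone \<rho> \<sigma> \<and> vec.dim \<rho> = 1"

definition primitive :: "int ^ 'n \<Rightarrow> bool" where
  "primitive p \<longleftrightarrow> p \<noteq> 0 \<and> (\<forall>k q. p = k *s q \<longrightarrow> \<bar>k\<bar> = 1)"

definition primitive_vector_on :: "int ^ 'n \<Rightarrow> (rat ^ 'n) set \<Rightarrow> bool" where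
  "primitive_vector_on p \<rho> \<longleftrightarrow> primitive p \<and> rat_vec p \<in> \<rho>"

definition ray_generators :: "(rat ^ 'n) set \<Rightarrow> (int ^ 'n) set" where
  "ray_generators \<sigma> = {p. \<exists>\<rho>. ray_of_cone \<rho> \<sigma> \<and> primitive_vector_on p \<rho>}"

definition demazure_root :: "(rat ^ 'n) set \<Rightarrow> int ^ 'n \<Rightarrow> int ^ 'n \<Rightarrow> bool" where
  "demazure_root \<sigma> p e \<longleftrightarrow>
     scalar_product p e = -1 \<and> (\<forall>q\<in>ray_generators \<sigma> - {p}. 0 \<le> scalar_product q e)"


subsection \<open>The affine toric variety of a cone\<close>

definition weight_semigroup :: "(rat ^ 'n) set \<Rightarrow> (int ^ 'n) set" where
  "weight_semigroup \<sigma> = {u. rat_vec u \<in> dual_cone \<sigma>}"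

text \<open>
  The algebra of Laurent polynomials in the \<open>\<chi>\<^sup>u\<close> is \<open>int ^ 'n \<Rightarrow>\<^sub>0 'k\<close> with the convolution
  product, \<open>\<chi>\<^sup>u\<close> being \<open>Poly_Mapping.single u 1\<close>.  The coordinate algebra of the toric
  variety is its subalgebra spanned by the \<open>\<chi>\<^sup>u\<close> with \<open>u\<close> in the weight semigroup.
\<close>

definition regular_functions ::
  "(rat ^ 'n) set \<Rightarrow> (int ^ 'n \<Rightarrow>\<^sub>0 'k::field) set" where
  "regular_functions \<sigma> = {f. Poly_Mapping.keys f \<subseteq> weight_semigroup \<sigma>}"

text \<open>
  A point \<open>x\<close> is encoded by the semigroup homomorphism \<open>u \<mapsto> \<chi>\<^sup>u(x)\<close>, so \<open>x u\<close> is the value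
  \<open>\<chi>\<^sup>u(x)\<close>.  Extensionality fixes the irrelevant values outside the semigroup, so that equal
  points are equal functions.
\<close>

definition toric_variety :: "(rat ^ 'n) set \<Rightarrow> (int ^ 'n \<Rightarrow> 'k::field) set" where
  "toric_variety \<sigma> = {x \<in> extensional (weight_semigroup \<sigma>).
     x 0 = 1 \<and> (\<forall>u\<in>weight_semigroup \<sigma>. \<forall>w\<in>weight_semigroup \<sigma>. x (u + w) = x u * x w)}"

text \<open>The value of \<open>f\<close> when each monomial with exponent \<open>m\<close> takes the value \<open>x m\<close>.\<close>

definition eval_at :: "('m \<Rightarrow>\<^sub>0 'k::field) \<Rightarrow> ('m \<Rightarrow> 'k) \<Rightarrow> 'k" where
  "eval_at f x = (\<Sum>m\<in>Poly_Mapping.keys f. Poly_Mapping.lookup f m * x m)"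

text \<open>The principal open sets form a basis of the Zariski topology.\<close>

definition principal_open ::
  "(rat ^ 'n) set \<Rightarrow> (int ^ 'n \<Rightarrow>\<^sub>0 'k::field) \<Rightarrow> (int ^ 'n \<Rightarrow> 'k) set" where
  "principal_open \<sigma> f = {x \<in> toric_variety \<sigma>. eval_at f x \<noteq> 0}"

definition zariski_topology :: "(rat ^ 'n) set \<Rightarrow> (int ^ 'n \<Rightarrow> 'k::field) topology" where
  "zariski_topology \<sigma> = topology_generated_by (principal_open \<sigma> ` regular_functions \<sigma>)"

text \<open>The torus orbit corresponding to the ray on which \<open>p\<close> is the primitive vector.\<close>

definition ray_orbit :: "(rat ^ 'n) set \<Rightarrow> int ^ 'n \<Rightarrow> (int ^ 'n \<Rightarrow> 'k::field) set" where
  "ray_orbit \<sigma> p = {x \<in> toric_variety \<sigma>. \<forall>u\<in>weight_semigroup \<sigma>.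
     (scalar_product p u = 0 \<longrightarrow> x u \<noteq> 0) \<and> (scalar_product p u \<noteq> 0 \<longrightarrow> x u = 0)}"


subsection \<open>The monoid structure of corank one\<close>

text \<open>
  The tensor square of the Laurent polynomial algebra is the semigroup algebra of pairs of
  exponents, \<open>\<chi>\<^sup>a \<otimes> \<chi>\<^sup>b\<close> being the monomial with exponent \<open>(a, b)\<close>; its value at a pair of
  points \<open>(x, y)\<close> is \<open>x a * y b\<close>.
\<close>

definition tensor_monomial ::
  "int ^ 'n \<Rightarrow> int ^ 'n \<Rightarrow> ((int ^ 'n) \<times> (int ^ 'n) \<Rightarrow>\<^sub>0 'k::field)" where
  "tensor_monomial a b = Poly_Mapping.single (a, b) 1"

text \<open>The image of \<open>\<chi>\<^sup>u\<close> under the comultiplication.\<close>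

definition comult :: "int ^ 'n \<Rightarrow> int ^ 'n \<Rightarrow> int ^ 'n \<Rightarrow> int ^ 'n \<Rightarrow>
    ((int ^ 'n) \<times> (int ^ 'n) \<Rightarrow>\<^sub>0 'k::field)" where
  "comult p e\<^sub>1 e\<^sub>2 u = tensor_monomial u u *
     (tensor_monomial 0 e\<^sub>1 + tensor_monomial e\<^sub>2 0) ^ nat (scalar_product p u)"

text \<open>
  The multiplication whose dual is \<open>comult\<close>.  If \<open>p\<close> is the primitive vector on a ray of \<open>\<sigma>\<close>,
  \<open>e\<^sub>1\<close> and \<open>e\<^sub>2\<close> are Demazure roots corresponding to \<open>p\<close> and \<open>u\<close> is in the weight semigroup,
  then both components of every exponent occurring in \<open>comult p e\<^sub>1 e\<^sub>2 u\<close> are in the weight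
  semigroup, so no value of a point outside the semigroup is used.
\<close>

definition toric_mult :: "(rat ^ 'n) set \<Rightarrow> int ^ 'n \<Rightarrow> int ^ 'n \<Rightarrow> int ^ 'n \<Rightarrow>
    (int ^ 'n \<Rightarrow> 'k::field) \<Rightarrow> (int ^ 'n \<Rightarrow> 'k) \<Rightarrow> (int ^ 'n \<Rightarrow> 'k)" where
  "toric_mult \<sigma> p e\<^sub>1 e\<^sub>2 x y =
     (\<lambda>u\<in>weight_semigroup \<sigma>. eval_at (comult p e\<^sub>1 e\<^sub>2 u) (\<lambda>(a, b). x a * y b))"

definition center :: "'a set \<Rightarrow> ('a \<Rightarrow> 'a \<Rightarrow> 'a) \<Rightarrow> 'a set" where
  "center X m = {x \<in> X. \<forall>y\<in>X. m x y = m y x}"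

end

theory Submission
  imports Defs
begin

text \<open>
  The binomial formula for the product compares, for a central point \<open>x\<close> and an exponent \<open>u\<close> with
  \<open>d = \<langle>p, u\<rangle>\<close>, the values of \<open>x\<close> at \<open>u + i e\<^sub>2\<close> with those at \<open>u + i e\<^sub>1\<close>.  It is symmetric in the two
  factors if \<open>e\<^sub>1 = e\<^sub>2\<close>.  If \<open>e\<^sub>1 \<noteq> e\<^sub>2\<close>, then it is enough to let \<open>x\<close> commute with the points \<open>t\<close> of
  the open orbit.  The condition \<open>x * t = t * x\<close> is then a linear relation between Laurent monomials
  in \<open>t\<close>, in which the monomial with exponent \<open>u + d e\<^sub>1\<close> occurs once if \<open>d > 0\<close>, with coefficient \<open>\<chi>\<^sup>u(x)\<close>.
  Independence of monomials gives \<open>\<chi>\<^sup>u(x) = 0\<close> (\<open>commuting_with_torus_imp_zero\<close>), which is to say that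
  \<open>x\<close> lies in the closure of the orbit (\<open>closure_of_ray_orbit\<close>), and the unit of the torus gives
  the equations for \<open>d = 1\<close>.

  Conversely, if \<open>\<chi>\<^sup>u(x)\<close> vanishes whenever \<open>\<langle>p, u\<rangle> > 0\<close>, then one term of each of the two products
  is left, and these are \<open>\<chi>\<^sup>u(y)\<close> multiplied with the values of \<open>x\<close> at \<open>u + d e\<^sub>2\<close> and at
  \<open>u + d e\<^sub>1\<close>.  These values agree because one root can be exchanged for the other in \<open>d\<close> steps,
  each of which is an instance of the equations for pairing one (\<open>exchange_roots\<close>).

  All this presupposes that the exponents \<open>u + i e\<^sub>1 + j e\<^sub>2\<close> with \<open>i + j \<le> d\<close> are in the weight semigroup.
  Demazure roots are defined by inequalities on ray generators, so this needs the theorem that a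
  strongly convex polyhedral cone is generated by its rays
  (\<open>weight_semigroup_iff_ray_generators\<close>), which follows from Farkas' lemma over the rationals.
\<close>


section \<open>Cones are determined by their rays\<close>

lemma scalar_product_add_left: "scalar_product (v + w) u = scalar_product v u + scalar_product w u"
  for u v w :: "'a::comm_ring_1 ^ 'n"
  by (simp add: scalar_product_def algebra_simps sum.distrib)

lemma scalar_product_add_right: "scalar_product v (u + w) = scalar_product v u + scalar_product v w"
  for u v w :: "'a::comm_ring_1 ^ 'n"
  by (simp add: scalar_product_def algebra_simps sum.distrib)

lemma scalar_product_scale_left: "scalar_product (c *s v) u = c * scalar_product v u"
  for u v :: "'a::comm_ring_1 ^ 'n"
  by (simp add: scalar_product_def algebra_simps sum_distrib_left)

lemma scalar_product_scale_right: "scalar_product v (c *s u) = c * scalar_product v u"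
  for u v :: "'a::comm_ring_1 ^ 'n"
  by (simp add: scalar_product_def algebra_simps sum_distrib_left)

lemma scalar_product_zero_left [simp]: "scalar_product 0 u = 0"
  for u :: "'a::comm_ring_1 ^ 'n"
  by (simp add: scalar_product_def)

lemma scalar_product_zero_right [simp]: "scalar_product v 0 = 0"
  for v :: "'a::comm_ring_1 ^ 'n"
  by (simp add: scalar_product_def)

lemma scalar_product_sum_left: "scalar_product (sum f I) u = (\<Sum>i\<in>I. scalar_product (f i) u)"
  for u :: "'a::comm_ring_1 ^ 'n"
  by (induction I rule: infinite_finite_induct) (auto simp: scalar_product_add_left)

lemma scalar_product_sum_right: "scalar_product v (sum f I) = (\<Sum>i\<in>I. scalar_product v (f i))"
  for v :: "'a::comm_ring_1 ^ 'n"
  by (induction I rule: infinite_finite_induct) (auto simp: scalar_product_add_right)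

lemmas scalar_product_linear =
  scalar_product_add_left scalar_product_add_right
  scalar_product_scale_left scalar_product_scale_right

lemma scalar_product_rat_vec: "scalar_product (rat_vec q) (rat_vec u) = of_int (scalar_product q u)"
  by (simp add: scalar_product_def rat_vec_def)

text \<open>
  Induction on the number of generators.  If the functional \<open>u\<close> that separates \<open>b\<close> from the other
  generators is negative on the new one, \<open>g\<close>, then project everything along \<open>g\<close> to the hyperplane
  \<open>u = 0\<close>: a representation of the projection of \<open>b\<close> would lift to one of \<open>b\<close>, because
  \<open>u b / u g > 0\<close> and \<open>- u (a i) / u g \<ge> 0\<close>.  So the projections can be separated, and composing
  with the projection gives a functional that vanishes on \<open>g\<close>.
  Families instead of sets allow projections of different generators to coincide.
\<close>

lemma farkas:
  fixes a :: "'i \<Rightarrow> 'a::linordered_field ^ 'n"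
  assumes "finite I"
    and "\<nexists>c. (\<forall>i\<in>I. 0 \<le> c i) \<and> b = (\<Sum>i\<in>I. c i *s a i)"
  shows "\<exists>u. (\<forall>i\<in>I. 0 \<le> scalar_product (a i) u) \<and> scalar_product b u < 0"
  using assms
proof (induction I arbitrary: a b rule: finite_induct)
  case empty
  then have "b \<noteq> 0" by auto
  then obtain k where k: "b $ k \<noteq> 0" by (auto simp: vec_eq_iff)
  have "scalar_product b (- b) = - (\<Sum>i\<in>UNIV. b $ i * b $ i)"
    by (simp add: scalar_product_def sum_negf)
  moreover have "0 < (\<Sum>i\<in>UNIV. b $ i * b $ i)"
    by (rule sum_pos2[of _ k]) (use k in \<open>auto simp: zero_less_mult_iff\<close>)
  ultimately show ?case by (metis empty_iff neg_less_0_iff_less)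
next
  case (insert g I)
  have not_in_I: "\<nexists>c. (\<forall>i\<in>I. 0 \<le> c i) \<and> b = (\<Sum>i\<in>I. c i *s a i)"
  proof
    assume "\<exists>c. (\<forall>i\<in>I. 0 \<le> c i) \<and> b = (\<Sum>i\<in>I. c i *s a i)"
    then obtain c where c: "\<forall>i\<in>I. 0 \<le> c i" "b = (\<Sum>i\<in>I. c i *s a i)" by blast
    have "(\<Sum>i\<in>I. (c(g := 0)) i *s a i) = (\<Sum>i\<in>I. c i *s a i)"
      by (rule sum.cong) (use insert.hyps in auto)
    then have "b = (\<Sum>i\<in>insert g I. (c(g := 0)) i *s a i)"
      using insert.hyps c by simp
    moreover have "\<forall>i\<in>insert g I. 0 \<le> (c(g := 0)) i" using c by auto
    ultimately show False using insert.prems by blast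
  qed
  obtain u where u: "\<forall>i\<in>I. 0 \<le> scalar_product (a i) u" "scalar_product b u < 0"
    using insert.IH[OF not_in_I] by blast
  define s where "s v = scalar_product v u" for v
  show ?case
  proof (cases "0 \<le> s (a g)")
    case True
    then show ?thesis using u by (intro exI[of _ u]) (auto simp: s_def)
  next
    case False
    then have neg: "s (a g) < 0" by simp
    define pr where "pr v = v - (s v / s (a g)) *s a g" for v
    have not_in_proj: "\<nexists>c. (\<forall>i\<in>I. 0 \<le> c i) \<and> pr b = (\<Sum>i\<in>I. c i *s pr (a i))"
    proof
      assume "\<exists>c. (\<forall>i\<in>I. 0 \<le> c i) \<and> pr b = (\<Sum>i\<in>I. c i *s pr (a i))"
      then obtain c where c: "\<forall>i\<in>I. 0 \<le> c i" "pr b = (\<Sum>i\<in>I. c i *s pr (a i))" by blast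
      define c' where "c' = c(g := s b / s (a g) + (\<Sum>i\<in>I. c i * (- s (a i) / s (a g))))"
      have "b = pr b + (s b / s (a g)) *s a g" by (simp add: pr_def)
      also have "pr b = (\<Sum>i\<in>I. c i *s a i + (c i * (- s (a i) / s (a g))) *s a g)"
        unfolding c(2) by (intro sum.cong) (simp_all add: pr_def vec_eq_iff algebra_simps)
      also have "\<dots> = (\<Sum>i\<in>I. c i *s a i) + (\<Sum>i\<in>I. c i * (- s (a i) / s (a g))) *s a g"
        by (simp only: vec.scale_sum_left sum.distrib)
      also have "(\<Sum>i\<in>I. c i *s a i) = (\<Sum>i\<in>I. c' i *s a i)"
        by (rule sum.cong) (use insert.hyps in \<open>auto simp: c'_def\<close>)
      finally have "b = (\<Sum>i\<in>insert g I. c' i *s a i)"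
        using insert.hyps by (simp add: c'_def vec_eq_iff algebra_simps)
      moreover have "0 \<le> c' i" if "i \<in> insert g I" for i
      proof (cases "i = g")
        case True
        have "0 \<le> s b / s (a g)" using u neg by (simp add: s_def divide_nonpos_neg)
        moreover have "0 \<le> (\<Sum>i\<in>I. c i * (- s (a i) / s (a g)))"
          using u neg c by (intro sum_nonneg mult_nonneg_nonneg divide_nonpos_neg) (auto simp: s_def)
        ultimately show ?thesis by (simp add: c'_def True)
      next
        case False
        then show ?thesis using c that by (simp add: c'_def)
      qed
      ultimately show False using insert.prems by blast
    qed
    obtain w where w: "\<forall>i\<in>I. 0 \<le> scalar_product (pr (a i)) w" "scalar_product (pr b) w < 0"
      using insert.IH[OF not_in_proj] by blast
    \<comment> \<open>the functional \<open>w \<circ> pr\<close>\<close>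
    define w' where "w' = w - (scalar_product (a g) w / s (a g)) *s u"
    have w': "scalar_product v w' = scalar_product (pr v) w" for v
    proof -
      have "scalar_product v w' = scalar_product v w - (scalar_product (a g) w / s (a g)) * s v"
        using scalar_product_add_right[of v w' "(scalar_product (a g) w / s (a g)) *s u"]
        by (simp add: w'_def s_def scalar_product_scale_right)
      moreover have "scalar_product (pr v) w = scalar_product v w - (s v / s (a g)) * scalar_product (a g) w"
        using scalar_product_add_left[of "pr v" "(s v / s (a g)) *s a g" w]
        by (simp add: pr_def scalar_product_scale_left)
      ultimately show ?thesis by simp
    qed
    have "pr (a g) = 0" using neg by (simp add: pr_def)
    then show ?thesis using w w' by (intro exI[of _ w']) auto
  qed
qed

lemma cone_generated_byI: "\<forall>g\<in>G. 0 \<le> c g \<Longrightarrow> (\<Sum>g\<in>G. c g *s g) \<in> cone_generated_by G"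
  by (auto simp: cone_generated_by_def)

lemma generator_in_cone:
  assumes "finite G" "g \<in> G"
  shows "g \<in> cone_generated_by G"
proof -
  have "(\<Sum>h\<in>G. (if h = g then 1 else 0) *s h) = (\<Sum>h\<in>G. if h = g then h else 0)"
    by (rule sum.cong) auto
  also have "\<dots> = g" using assms by simp
  finally show ?thesis
    using cone_generated_byI[of G "\<lambda>h. if h = g then 1 else 0"] by simp
qed

lemma cone_generated_by_scale:
  assumes "v \<in> cone_generated_by G" "0 \<le> c"
  shows "c *s v \<in> cone_generated_by G"
proof -
  obtain a where a: "\<forall>g\<in>G. 0 \<le> a g" "v = (\<Sum>g\<in>G. a g *s g)"
    using assms by (auto simp: cone_generated_by_def)
  have "c *s v = (\<Sum>g\<in>G. (c * a g) *s g)" by (simp add: a vec.scale_sum_right)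
  then show ?thesis using cone_generated_byI[of G "\<lambda>g. c * a g"] a assms by simp
qed

lemma cone_generated_by_remove:
  assumes "finite G" "g \<in> G" "g \<in> cone_generated_by (G - {g})"
  shows "cone_generated_by (G - {g}) = cone_generated_by G"
proof (intro equalityI subsetI)
  fix v assume "v \<in> cone_generated_by (G - {g})"
  then obtain c where c: "\<forall>h\<in>G-{g}. 0 \<le> c h" "v = (\<Sum>h\<in>G-{g}. c h *s h)"
    by (auto simp: cone_generated_by_def)
  have "(\<Sum>h\<in>G-{g}. (c(g := 0)) h *s h) = (\<Sum>h\<in>G-{g}. c h *s h)"
    by (rule sum.cong) auto
  then have "v = (\<Sum>h\<in>G. (c(g := 0)) h *s h)"
    using assms c by (simp add: sum.remove[of G g])
  then show "v \<in> cone_generated_by G"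
    using cone_generated_byI[of G "c(g := 0)"] c by simp
next
  fix v assume "v \<in> cone_generated_by G"
  then obtain c where c: "\<forall>h\<in>G. 0 \<le> c h" "v = (\<Sum>h\<in>G. c h *s h)"
    by (auto simp: cone_generated_by_def)
  obtain d where d: "\<forall>h\<in>G-{g}. 0 \<le> d h" "g = (\<Sum>h\<in>G-{g}. d h *s h)"
    using assms(3) by (auto simp: cone_generated_by_def)
  have "v = c g *s g + (\<Sum>h\<in>G-{g}. c h *s h)"
    using assms c by (simp add: sum.remove[of G g])
  also have "\<dots> = (\<Sum>h\<in>G-{g}. (c g * d h + c h) *s h)"
    by (subst (2) d(2)) (simp add: vec.scale_sum_right vec.scale_left_distrib sum.distrib)
  finally show "v \<in> cone_generated_by (G - {g})"
    using cone_generated_byI[of "G - {g}" "\<lambda>h. c g * d h + c h"] c d assms(2) by simp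
qed

text \<open>
  A vector of least size among the lattice vectors on the half-line: a non-trivial
  integer factor could be divided out.
\<close>

lemma exists_primitive_on_half_line:
  fixes g :: "rat ^ 'n"
  assumes "g \<noteq> 0"
  shows "\<exists>p c. 0 < c \<and> rat_vec p = c *s g \<and> primitive p"
proof -
  define P where "P p \<longleftrightarrow> (\<exists>c>0. rat_vec p = c *s g)" for p :: "int ^ 'n"
  define size where "size p = (\<Sum>i\<in>UNIV. nat \<bar>p $ i\<bar>)" for p :: "int ^ 'n"
  define D where "D = (\<Prod>i\<in>UNIV. snd (quotient_of (g $ i)))"
  have D: "0 < D" unfolding D_def by (intro prod_pos) (simp add: quotient_of_denom_pos')
  have "\<exists>m. of_int m = of_int D * g $ i" for i
  proof -
    obtain a b where ab: "quotient_of (g $ i) = (a, b)" by (cases "quotient_of (g $ i)")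
    have "snd (quotient_of (g $ i)) dvd D" unfolding D_def by (rule dvd_prodI) auto
    then obtain k where k: "D = b * k" unfolding ab by auto
    have "g $ i = of_int a / of_int b" "b \<noteq> 0"
      using quotient_of_div[OF ab] quotient_of_denom_pos[OF ab] by auto
    then have "of_int (a * k) = of_int D * g $ i" by (simp add: k)
    then show ?thesis by blast
  qed
  then obtain m where m: "\<And>i. of_int (m i) = of_int D * g $ i" by metis
  have "P (\<chi> i. m i)"
    unfolding P_def using D m by (intro exI[of _ "of_int D"]) (simp add: rat_vec_def vec_eq_iff)
  then obtain p where p: "P p" and least: "\<And>q. P q \<Longrightarrow> size p \<le> size q"
    using ex_has_least_nat[of P _ size] by blast
  obtain c where c: "c > 0" "rat_vec p = c *s g" using p by (auto simp: P_def)
  have "primitive p"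
    unfolding primitive_def
  proof (intro conjI allI impI)
    have "rat_vec p \<noteq> 0" using c assms by simp
    then show p0: "p \<noteq> 0" by (auto simp: rat_vec_def vec_eq_iff)
    fix k q assume kq: "p = k *s q"
    have k0: "k \<noteq> 0" using kq p0 by auto
    have "P (sgn k *s q)"
      unfolding P_def
    proof (intro exI[of _ "c / of_int \<bar>k\<bar>"] conjI)
      show "0 < c / of_int \<bar>k\<bar>" using c k0 by simp
      have "of_int \<bar>k\<bar> * (of_int (sgn k * q $ i)) = c * g $ i" for i
      proof -
        have "\<bar>k\<bar> * (sgn k * q $ i) = p $ i" by (simp add: kq abs_mult_sgn flip: mult.assoc)
        then have "of_int \<bar>k\<bar> * (of_int (sgn k * q $ i)) = (of_int (p $ i) :: rat)"
          by (metis of_int_mult)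
        also have "\<dots> = c * g $ i" using c(2) by (simp add: rat_vec_def vec_eq_iff)
        finally show ?thesis .
      qed
      then show "rat_vec (sgn k *s q) = (c / of_int \<bar>k\<bar>) *s g"
        using k0 by (simp add: rat_vec_def vec_eq_iff field_simps)
    qed
    then have "size p \<le> size (sgn k *s q)" by (rule least)
    moreover have "size p = nat \<bar>k\<bar> * size (sgn k *s q)"
      using k0 by (simp add: size_def kq sum_distrib_left abs_mult nat_mult_distrib abs_sgn_eq)
    moreover have "size p \<noteq> 0" using p0 by (auto simp: size_def vec_eq_iff)
    ultimately have "nat \<bar>k\<bar> * size (sgn k *s q) \<le> 1 * size (sgn k *s q)" "size (sgn k *s q) \<noteq> 0"
      by auto
    then have "nat \<bar>k\<bar> \<le> 1" by (metis mult_le_cancel2 bot_nat_0.not_eq_extremum)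
    then show "\<bar>k\<bar> = 1" using k0 by linarith
  qed
  then show ?thesis using c by blast
qed

lemma dim_half_line:
  fixes g :: "rat ^ 'n"
  assumes "g \<noteq> 0"
  shows "vec.dim {c *s g | c. 0 \<le> c} = 1"
proof (rule vec.dim_unique[of "{g}"])
  show "{g} \<subseteq> {c *s g | c. 0 \<le> c}"
    by (auto intro!: exI[of _ "1::rat"])
  show "{c *s g | c. 0 \<le> c} \<subseteq> vec.span {g}"
    by (auto simp: vec.span_scale vec.span_base)
qed (use assms in \<open>auto simp: vec.dependent_single\<close>)

text \<open>
  For every other generator \<open>h\<close> there is a functional that is nonnegative on the cone, zero on \<open>g\<close>
  and positive on \<open>h\<close>: otherwise Farkas writes \<open>- h\<close> as a combination of the generators and \<open>- g\<close>,
  so that \<open>h\<close> plus a vector of the cone is a multiple of \<open>g\<close>.  A positive multiple contradicts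
  the irredundance of \<open>g\<close>, any other one puts \<open>- h\<close> into the cone.  The sum of these functionals
  cuts out the half-line of \<open>g\<close>.
\<close>

lemma irredundant_generator_spans_ray:
  fixes G :: "(rat ^ 'n) set"
  assumes "finite G" "g \<in> G"
    and pointed: "cone_generated_by G \<inter> uminus ` cone_generated_by G = {0}"
    and irredundant: "\<And>h. h \<in> G \<Longrightarrow> h \<notin> cone_generated_by (G - {h})"
  shows "ray_of_cone {c *s g | c. 0 \<le> c} (cone_generated_by G)"
proof -
  have nonzero: "h \<noteq> 0" if "h \<in> G" for h
    using irredundant[OF that] cone_generated_byI[of "G - {h}" "\<lambda>_. 0"] by auto
  have "\<exists>u. (\<forall>k\<in>G. 0 \<le> scalar_product k u) \<and> scalar_product g u = 0 \<and> 0 < scalar_product h u"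
    if h: "h \<in> G - {g}" for h
  proof -
    \<comment> \<open>the index \<open>None\<close> stands for the additional generator \<open>- g\<close>\<close>
    define a where "a i = (case i of None \<Rightarrow> - g | Some k \<Rightarrow> k)" for i
    define I where "I = insert None (Some ` G)"
    have "\<nexists>c. (\<forall>i\<in>I. 0 \<le> c i) \<and> - h = (\<Sum>i\<in>I. c i *s a i)"
    proof
      assume "\<exists>c. (\<forall>i\<in>I. 0 \<le> c i) \<and> - h = (\<Sum>i\<in>I. c i *s a i)"
      then obtain c where c: "\<And>i. i \<in> I \<Longrightarrow> 0 \<le> c i" "- h = (\<Sum>i\<in>I. c i *s a i)" by blast
      define s where "s = c None - c (Some g)"
      define d where "d k = c (Some k) + (if k = h then 1 else 0)" for k
      have d_nonneg: "0 \<le> d k" if "k \<in> G" for k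
        using c(1)[of "Some k"] that by (simp add: d_def I_def)
      have "- h = c None *s (- g) + (\<Sum>k\<in>G. c (Some k) *s k)"
        unfolding c(2) I_def using assms(1)
        by (simp add: a_def sum.reindex)
      also have "(\<Sum>k\<in>G. c (Some k) *s k) = c (Some g) *s g + (\<Sum>k\<in>G-{g}. c (Some k) *s k)"
        using assms by (simp add: sum.remove[of G g])
      finally have "h + (\<Sum>k\<in>G-{g}. c (Some k) *s k) = s *s g"
        by (simp add: s_def vec_eq_iff algebra_simps)
      moreover have "(\<Sum>k\<in>G-{g}. d k *s k) = h + (\<Sum>k\<in>G-{g}. c (Some k) *s k)"
      proof -
        have "(\<Sum>k\<in>G-{g}. d k *s k) =
            (\<Sum>k\<in>G-{g}. if k = h then k else 0) + (\<Sum>k\<in>G-{g}. c (Some k) *s k)"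
          unfolding sum.distrib[symmetric]
          by (rule sum.cong) (auto simp: d_def vec.scale_left_distrib)
        then show ?thesis using h assms by simp
      qed
      ultimately have sum_d: "(\<Sum>k\<in>G-{g}. d k *s k) = s *s g" by simp
      show False
      proof (cases "0 < s")
        case True
        have "(\<Sum>k\<in>G-{g}. d k *s k) \<in> cone_generated_by (G - {g})"
          by (rule cone_generated_byI) (use d_nonneg in auto)
        then have "(1 / s) *s (s *s g) \<in> cone_generated_by (G - {g})"
          unfolding sum_d by (rule cone_generated_by_scale) (use True in simp)
        then show False using True irredundant[OF \<open>g \<in> G\<close>] by simp
      next
        case False
        define f where "f k = (if k = g then - s else if k = h then d k - 1 else d k)" for k
        have "(\<Sum>k\<in>G. f k *s k) = - s *s g + (\<Sum>k\<in>G-{g}. f k *s k)"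
          using assms by (simp add: sum.remove[of G g] f_def)
        also have "(\<Sum>k\<in>G-{g}. f k *s k) = (\<Sum>k\<in>G-{g}. d k *s k) - (\<Sum>k\<in>G-{g}. if k = h then k else 0)"
          unfolding sum_subtractf[symmetric]
          by (rule sum.cong) (auto simp: f_def vec.scale_left_diff_distrib)
        also have "\<dots> = s *s g - h" using h assms sum_d by simp
        finally have "(\<Sum>k\<in>G. f k *s k) = - h" by (simp add: vec_eq_iff)
        moreover have "0 \<le> f k" if "k \<in> G" for k
          using False d_nonneg that c(1)[of "Some k"] by (auto simp: f_def d_def I_def)
        ultimately have "- h \<in> cone_generated_by G"
          using cone_generated_byI[of G f] by simp
        moreover have "h \<in> cone_generated_by G" using h assms by (simp add: generator_in_cone)
        ultimately have "h \<in> cone_generated_by G \<inter> uminus ` cone_generated_by G"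
          by (metis IntI add.inverse_inverse image_eqI)
        then show False using pointed nonzero h by auto
      qed
    qed
    then obtain u where u: "\<forall>i\<in>I. 0 \<le> scalar_product (a i) u" "scalar_product (- h) u < 0"
      using farkas[of I "- h" a] assms(1) by (auto simp: I_def)
    have minus: "scalar_product (- v) u = - scalar_product v u" for v
      by (simp add: scalar_product_def sum_negf)
    have "\<forall>k\<in>G. 0 \<le> scalar_product k u" using u(1) by (auto simp: I_def a_def)
    moreover have "scalar_product g u \<le> 0" using u(1) by (auto simp: I_def a_def minus)
    ultimately show ?thesis using u(2) \<open>g \<in> G\<close> by (intro exI[of _ u]) (auto simp: minus intro: antisym)
  qed
  then obtain U where U: "\<And>h k. h \<in> G - {g} \<Longrightarrow> k \<in> G \<Longrightarrow> 0 \<le> scalar_product k (U h)"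
      "\<And>h. h \<in> G - {g} \<Longrightarrow> scalar_product g (U h) = 0"
      "\<And>h. h \<in> G - {g} \<Longrightarrow> 0 < scalar_product h (U h)"
    by metis
  define u where "u = (\<Sum>h\<in>G-{g}. U h)"
  have u_g: "scalar_product g u = 0" by (simp add: u_def scalar_product_sum_right U)
  have u_pos: "0 < scalar_product k u" if "k \<in> G - {g}" for k
    unfolding u_def scalar_product_sum_right
    by (rule sum_pos2[of _ k]) (use assms that U in auto)
  have u_nonneg: "0 \<le> scalar_product k u" if "k \<in> G" for k
    using u_g u_pos[of k] that by (cases "k = g") auto
  have "0 \<le> scalar_product v u" if "v \<in> cone_generated_by G" for v
    using that u_nonneg
    by (fastforce simp: cone_generated_by_def scalar_product_sum_left scalar_product_scale_left
        intro: sum_nonneg)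
  then have "u \<in> dual_cone (cone_generated_by G)" by (simp add: dual_cone_def)
  moreover have "{c *s g | c. 0 \<le> c} = {v \<in> cone_generated_by G. scalar_product v u = 0}"
  proof (intro equalityI subsetI)
    fix v assume "v \<in> {c *s g | c. 0 \<le> c}"
    then show "v \<in> {v \<in> cone_generated_by G. scalar_product v u = 0}"
      using assms u_g by (auto simp: scalar_product_scale_left cone_generated_by_scale generator_in_cone)
  next
    fix v assume v: "v \<in> {v \<in> cone_generated_by G. scalar_product v u = 0}"
    then obtain c where c: "\<forall>h\<in>G. 0 \<le> c h" "v = (\<Sum>h\<in>G. c h *s h)"
      by (auto simp: cone_generated_by_def)
    have "(\<Sum>h\<in>G. c h * scalar_product h u) = 0"
      using v by (simp add: c scalar_product_sum_left scalar_product_scale_left)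
    then have "\<forall>h\<in>G. c h * scalar_product h u = 0"
      using assms(1) c u_nonneg by (subst (asm) sum_nonneg_eq_0_iff) auto
    then have "c h = 0" if "h \<in> G - {g}" for h using u_pos[OF that] that by fastforce
    then have "v = c g *s g" using assms c by (simp add: sum.remove[of G g])
    then show "v \<in> {c *s g | c. 0 \<le> c}" using c assms by auto
  qed
  ultimately show ?thesis
    using dim_half_line[OF nonzero[OF \<open>g \<in> G\<close>]] unfolding ray_of_cone_def face_of_cone_def by blast
qed

text \<open>
  A generating set of least cardinality is irredundant, so each of its elements is a positive multiple
  of a primitive vector on a ray, and the cone is generated by these primitive vectors.
\<close>

lemma weight_semigroup_iff_ray_generators:
  fixes \<sigma> :: "(rat ^ 'n) set"
  assumes "strongly_convex_polyhedral_cone \<sigma>"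
  shows "u \<in> weight_semigroup \<sigma> \<longleftrightarrow> (\<forall>q\<in>ray_generators \<sigma>. 0 \<le> scalar_product q u)"
proof
  assume u: "u \<in> weight_semigroup \<sigma>"
  show "\<forall>q\<in>ray_generators \<sigma>. 0 \<le> scalar_product q u"
  proof
    fix q assume "q \<in> ray_generators \<sigma>"
    then have "rat_vec q \<in> \<sigma>"
      by (auto simp: ray_generators_def ray_of_cone_def face_of_cone_def primitive_vector_on_def)
    then have "0 \<le> scalar_product (rat_vec q) (rat_vec u)"
      using u by (auto simp: weight_semigroup_def dual_cone_def)
    then show "0 \<le> scalar_product q u" by (simp add: scalar_product_rat_vec)
  qed
next
  assume nonneg: "\<forall>q\<in>ray_generators \<sigma>. 0 \<le> scalar_product q u"
  define P where "P G \<longleftrightarrow> finite G \<and> \<sigma> = cone_generated_by G" for G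
  obtain G0 where "P G0"
    using assms by (auto simp: strongly_convex_polyhedral_cone_def polyhedral_cone_def P_def)
  then obtain G where G: "P G" and least: "\<And>H. P H \<Longrightarrow> card G \<le> card H"
    using ex_has_least_nat[of P _ card] by blast
  have fin: "finite G" and \<sigma>: "\<sigma> = cone_generated_by G" using G by (auto simp: P_def)
  have irredundant: "h \<notin> cone_generated_by (G - {h})" if "h \<in> G" for h
  proof
    assume "h \<in> cone_generated_by (G - {h})"
    then have "P (G - {h})"
      unfolding P_def using fin \<sigma> cone_generated_by_remove[OF fin that] by blast
    then show False using least[of "G - {h}"] that fin by (metis card_Diff1_less leD)
  qed
  have gen: "0 \<le> scalar_product g (rat_vec u)" if g: "g \<in> G" for g
  proof -
    have "g \<noteq> 0"
      using irredundant[OF g] cone_generated_byI[of "G - {g}" "\<lambda>_. 0"] by auto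
    then obtain q c where q: "0 < c" "rat_vec q = c *s g" "primitive q"
      using exists_primitive_on_half_line by blast
    have "ray_of_cone {c *s g | c. 0 \<le> c} \<sigma>"
      unfolding \<sigma> using assms irredundant fin g
      by (intro irredundant_generator_spans_ray) (auto simp: strongly_convex_polyhedral_cone_def \<sigma>)
    moreover have "primitive_vector_on q {c *s g | c. 0 \<le> c}"
      using q by (auto simp: primitive_vector_on_def)
    ultimately have "q \<in> ray_generators \<sigma>" by (auto simp: ray_generators_def)
    then have "0 \<le> c * scalar_product g (rat_vec u)"
      using nonneg by (simp add: scalar_product_rat_vec flip: q(2) scalar_product_scale_left)
    then show ?thesis using q by (simp add: zero_le_mult_iff)
  qed
  have "0 \<le> scalar_product v (rat_vec u)" if "v \<in> \<sigma>" for v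
    using that gen unfolding \<sigma>
    by (fastforce simp: cone_generated_by_def scalar_product_sum_left scalar_product_scale_left
        intro: sum_nonneg)
  then show "u \<in> weight_semigroup \<sigma>" by (simp add: weight_semigroup_def dual_cone_def)
qed

lemma scalar_product_add_demazure_root:
  "demazure_root \<sigma> p e \<Longrightarrow> scalar_product p (u + k *s e) = scalar_product p u - k"
  by (simp add: scalar_product_linear demazure_root_def)

text \<open>
  A Demazure root lowers the pairing with \<open>p\<close> by one and does not lower any other one.
\<close>

lemma weight_semigroup_add_demazure_roots:
  fixes \<sigma> :: "(rat ^ 'n) set"
  assumes "strongly_convex_polyhedral_cone \<sigma>"
    and "demazure_root \<sigma> p e\<^sub>1" "demazure_root \<sigma> p e\<^sub>2"
    and u: "u \<in> weight_semigroup \<sigma>" and le: "int (i + j) \<le> scalar_product p u"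
  shows "u + int i *s e\<^sub>1 + int j *s e\<^sub>2 \<in> weight_semigroup \<sigma>"
  unfolding weight_semigroup_iff_ray_generators[OF assms(1)]
proof
  fix q assume q: "q \<in> ray_generators \<sigma>"
  show "0 \<le> scalar_product q (u + int i *s e\<^sub>1 + int j *s e\<^sub>2)"
  proof (cases "q = p")
    case True
    then show ?thesis using assms by (simp add: scalar_product_linear demazure_root_def)
  next
    case False
    then show ?thesis
      using assms q by (auto simp: scalar_product_linear demazure_root_def weight_semigroup_iff_ray_generators)
  qed
qed


section \<open>Evaluation at a point\<close>

lemma eval_at_superset:
  assumes "finite A" "Poly_Mapping.keys f \<subseteq> A"
  shows "eval_at f x = (\<Sum>m\<in>A. Poly_Mapping.lookup f m * x m)"
  unfolding eval_at_def
  by (rule sum.mono_neutral_left) (use assms in \<open>auto simp: in_keys_iff\<close>)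

lemma eval_at_zero [simp]: "eval_at 0 x = 0"
  by (simp add: eval_at_def)

lemma eval_at_single [simp]: "eval_at (Poly_Mapping.single m c) x = c * x m"
  by (subst eval_at_superset[of "{m}"]) auto

lemma eval_at_add: "eval_at (f + g) x = eval_at f x + eval_at g x"
proof -
  let ?A = "Poly_Mapping.keys f \<union> Poly_Mapping.keys g"
  have "eval_at (f + g) x = (\<Sum>m\<in>?A. Poly_Mapping.lookup (f + g) m * x m)"
    by (rule eval_at_superset) (use Poly_Mapping.keys_add[of f g] in auto)
  also have "\<dots> = eval_at f x + eval_at g x"
    by (simp add: eval_at_superset[of ?A] lookup_add distrib_right sum.distrib)
  finally show ?thesis .
qed

lemma eval_at_sum: "eval_at (sum f I) x = (\<Sum>i\<in>I. eval_at (f i) x)"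
  by (induction I rule: infinite_finite_induct) (auto simp: eval_at_add)

lemma sum_of_monomials:
  "f = (\<Sum>m\<in>Poly_Mapping.keys f. Poly_Mapping.single m (Poly_Mapping.lookup f m))"
  by (rule poly_mapping_eqI)
    (auto simp: lookup_sum lookup_single when_def in_keys_iff sum.delta cong: if_cong)

lemma eval_at_mult:
  assumes "\<And>a b. a \<in> Poly_Mapping.keys f \<Longrightarrow> b \<in> Poly_Mapping.keys g \<Longrightarrow> x (a + b) = x a * x b"
  shows "eval_at (f * g) x = eval_at f x * eval_at g x"
proof -
  have "f * g = (\<Sum>a\<in>Poly_Mapping.keys f. \<Sum>b\<in>Poly_Mapping.keys g.
      Poly_Mapping.single (a + b) (Poly_Mapping.lookup f a * Poly_Mapping.lookup g b))"
    by (subst sum_of_monomials[of f], subst sum_of_monomials[of g])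
      (simp add: sum_product mult_single)
  then have "eval_at (f * g) x = (\<Sum>a\<in>Poly_Mapping.keys f. \<Sum>b\<in>Poly_Mapping.keys g.
      Poly_Mapping.lookup f a * Poly_Mapping.lookup g b * (x a * x b))"
    by (simp add: eval_at_sum assms)
  also have "\<dots> = eval_at f x * eval_at g x"
    by (simp add: eval_at_def sum_product algebra_simps)
  finally show ?thesis .
qed

text \<open>
  The binomial expansion of the comultiplication, evaluated at a pair of points: the explicit
  formula for \<open>\<chi>\<^sup>u(x * y)\<close>.
\<close>

lemma eval_at_comult:
  fixes x y :: "int ^ 'n \<Rightarrow> 'k::field" and p u e\<^sub>1 e\<^sub>2 :: "int ^ 'n"
  defines "d \<equiv> nat (scalar_product p u)"
  shows "eval_at (comult p e\<^sub>1 e\<^sub>2 u) (\<lambda>(a, b). x a * y b) =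
    (\<Sum>i\<le>d. of_nat (d choose i) * x (u + int i *s e\<^sub>2) * y (u + int (d - i) *s e\<^sub>1))"
proof -
  have power1: "(tensor_monomial 0 e\<^sub>1 :: _ \<Rightarrow>\<^sub>0 'k) ^ j = tensor_monomial 0 (int j *s e\<^sub>1)" for j
    by (induction j)
      (simp_all add: tensor_monomial_def mult_single vec.scale_left_distrib zero_prod_def[symmetric])
  have power2: "(tensor_monomial e\<^sub>2 0 :: _ \<Rightarrow>\<^sub>0 'k) ^ j = tensor_monomial (int j *s e\<^sub>2) 0" for j
    by (induction j)
      (simp_all add: tensor_monomial_def mult_single vec.scale_left_distrib zero_prod_def[symmetric])
  have of_nat: "of_nat c = (Poly_Mapping.single 0 (of_nat c) :: (int ^ 'n) \<times> (int ^ 'n) \<Rightarrow>\<^sub>0 'k)" for c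
    by (induction c) (simp_all add: single_add)
  have "(comult p e\<^sub>1 e\<^sub>2 u :: _ \<Rightarrow>\<^sub>0 'k) = tensor_monomial u u *
      (\<Sum>i\<le>d. of_nat (d choose i) * tensor_monomial e\<^sub>2 0 ^ i * tensor_monomial 0 e\<^sub>1 ^ (d - i))"
    unfolding comult_def d_def by (subst add.commute, subst binomial_ring) simp
  also have "\<dots> = (\<Sum>i\<le>d. Poly_Mapping.single
      (u + int i *s e\<^sub>2, u + int (d - i) *s e\<^sub>1) (of_nat (d choose i)))"
    unfolding power1 power2 of_nat
    by (simp add: tensor_monomial_def mult_single sum_distrib_left zero_prod_def)
  finally show ?thesis by (simp add: eval_at_sum mult.assoc)
qed


section \<open>Laurent monomials on the torus\<close>

definition torus :: "('k::field ^ 'n) set" where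
  "torus = {t. \<forall>i. t $ i \<noteq> 0}"

definition laurent_monomial :: "int ^ 'n \<Rightarrow> 'k::field ^ 'n \<Rightarrow> 'k" where
  "laurent_monomial m t = (\<Prod>i\<in>UNIV. t $ i powi m $ i)"

lemma laurent_monomial_nonzero: "t \<in> torus \<Longrightarrow> laurent_monomial m t \<noteq> 0"
  by (auto simp: torus_def laurent_monomial_def)

lemma laurent_monomial_zero [simp]: "laurent_monomial 0 t = 1"
  by (simp add: laurent_monomial_def)

lemma laurent_monomial_add:
  "t \<in> torus \<Longrightarrow> laurent_monomial (m + l) t = laurent_monomial m t * laurent_monomial l t"
  by (simp add: torus_def laurent_monomial_def power_int_add prod.distrib)

lemma torus_mult: "s \<in> torus \<Longrightarrow> t \<in> torus \<Longrightarrow> s * t \<in> torus"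
  by (simp add: torus_def)

lemma laurent_monomial_mult:
  "laurent_monomial m (s * t) = laurent_monomial m s * laurent_monomial m t"
  by (simp add: laurent_monomial_def power_int_mult_distrib prod.distrib)

lemma one_in_torus [simp]: "1 \<in> torus"
  by (simp add: torus_def)

lemma laurent_monomial_one [simp]: "laurent_monomial m 1 = 1"
  by (simp add: laurent_monomial_def)

lemma power_int_two_inject:
  fixes a b :: int
  assumes "(2::'k::field_char_0) powi a = 2 powi b"
  shows "a = b"
proof -
  have le: "a = b" if "(2::'k) powi a = 2 powi b" "a \<le> b" for a b :: int
  proof -
    have "(2::'k) powi b = 2 powi (b - a) * 2 powi a"
      by (simp flip: power_int_add)
    then have "(2::'k) powi (b - a) = 1" using that by simp
    then have "(2::'k) ^ nat (b - a) = 1"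
      using that by (simp add: power_int_def)
    then have "of_nat (2 ^ nat (b - a)) = (of_nat 1 :: 'k)" by simp
    then have "2 ^ nat (b - a) = (1::nat)" by (simp only: of_nat_eq_iff)
    then show ?thesis using that by (simp add: power_eq_1_iff)
  qed
  show ?thesis by (metis le assms linear)
qed

text \<open>
  In characteristic zero the element \<open>2\<close> has infinite order, so it separates the integer powers
  in a coordinate where the exponents differ.
\<close>

lemma laurent_monomials_separated:
  fixes m l :: "int ^ 'n"
  assumes "m \<noteq> l"
  shows "\<exists>t::'k::field_char_0 ^ 'n. t \<in> torus \<and> laurent_monomial m t \<noteq> laurent_monomial l t"
proof -
  obtain i where i: "m $ i \<noteq> l $ i" using assms by (auto simp: vec_eq_iff)
  define t :: "'k ^ 'n" where "t = (\<chi> j. if j = i then 2 else 1)"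
  have "laurent_monomial k t = 2 powi (k $ i)" for k
  proof -
    have "laurent_monomial k t = (\<Prod>j\<in>UNIV. if j = i then 2 powi (k $ i) else 1)"
      unfolding laurent_monomial_def t_def by (rule prod.cong) auto
    then show ?thesis by simp
  qed
  moreover have "t \<in> torus" by (simp add: torus_def t_def)
  ultimately show ?thesis using i power_int_two_inject by metis
qed

text \<open>
  Dedekind's argument: translating the relation by an \<open>s\<close> at which the monomials with exponents
  \<open>m k\<close> and \<open>m0\<close> take different values, and subtracting a multiple of the relation itself, eliminates
  the term \<open>k\<close> and multiplies the coefficient \<open>c0\<close> by a nonzero number.  As only \<open>m0\<close> has to be
  different from the other exponents, these may coincide with each other, as they can in the
  relation that expresses commutation.
\<close>

lemma laurent_monomial_isolated_coefficient:
  fixes c :: "'i \<Rightarrow> 'k::field_char_0" and m :: "'i \<Rightarrow> int ^ 'n"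
  assumes "finite J" and "\<And>k. k \<in> J \<Longrightarrow> m k \<noteq> m0"
    and "\<And>t. t \<in> torus \<Longrightarrow>
      c0 * laurent_monomial m0 t + (\<Sum>k\<in>J. c k * laurent_monomial (m k) t) = 0"
  shows "c0 = 0"
  using assms
proof (induction J arbitrary: c c0 rule: finite_induct)
  case empty
  then show ?case using empty(2)[of 1] by simp
next
  case (insert k J)
  obtain s :: "'k ^ 'n" where s: "s \<in> torus" "laurent_monomial m0 s \<noteq> laurent_monomial (m k) s"
    using laurent_monomials_separated insert.prems(1)[of k] by (metis insertI1)
  let ?d = "\<lambda>l. laurent_monomial l s - laurent_monomial (m k) s"
  have "c0 * ?d m0 = 0"
  proof (rule insert.IH[of "c0 * ?d m0" "\<lambda>j. c j * ?d (m j)"])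
    fix t :: "'k ^ 'n" assume t: "t \<in> torus"
    let ?rel = "\<lambda>t. c0 * laurent_monomial m0 t + (\<Sum>j\<in>insert k J. c j * laurent_monomial (m j) t)"
    have "c0 * ?d m0 * laurent_monomial m0 t + (\<Sum>j\<in>J. c j * ?d (m j) * laurent_monomial (m j) t) =
        ?rel (s * t) - laurent_monomial (m k) s * ?rel t"
      using insert.hyps
      by (simp add: laurent_monomial_mult algebra_simps sum_subtractf sum_distrib_left)
    moreover have "?rel (s * t) = 0" by (rule insert.prems(2)[OF torus_mult[OF s(1) t]])
    moreover have "?rel t = 0" by (rule insert.prems(2)[OF t])
    ultimately show "c0 * ?d m0 * laurent_monomial m0 t +
        (\<Sum>j\<in>J. c j * ?d (m j) * laurent_monomial (m j) t) = 0"
      by (simp only: mult_zero_right diff_zero)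
  qed (use insert.prems in auto)
  then show ?case using s by simp
qed

lemma laurent_monomials_independent:
  fixes c :: "int ^ 'n \<Rightarrow> 'k::field_char_0"
  assumes "finite A" and "\<And>t. t \<in> torus \<Longrightarrow> (\<Sum>m\<in>A. c m * laurent_monomial m t) = 0"
    and "l \<in> A"
  shows "c l = 0"
  by (rule laurent_monomial_isolated_coefficient[of "A - {l}" "\<lambda>m. m" l "c l" c])
    (use assms in \<open>auto simp: sum.remove[of A l]\<close>)


section \<open>The closure of a ray orbit\<close>

lemma zero_in_weight_semigroup [simp]: "0 \<in> weight_semigroup \<sigma>"
  by (simp add: weight_semigroup_def dual_cone_def rat_vec_def scalar_product_def)

lemma weight_semigroup_add:
  "u \<in> weight_semigroup \<sigma> \<Longrightarrow> w \<in> weight_semigroup \<sigma> \<Longrightarrow> u + w \<in> weight_semigroup \<sigma>"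
  by (auto simp: weight_semigroup_def dual_cone_def rat_vec_def scalar_product_def algebra_simps sum.distrib)

text \<open>
  The point of the toric variety with support on the exponents orthogonal to \<open>p\<close>, obtained from
  a point of the torus.  These points lie in the orbit of the ray if \<open>p\<close> is its primitive vector, and
  taking \<open>p = 0\<close> gives the points of the open orbit.
\<close>

definition orbit_point :: "(rat ^ 'n) set \<Rightarrow> int ^ 'n \<Rightarrow> 'k::field ^ 'n \<Rightarrow> int ^ 'n \<Rightarrow> 'k" where
  "orbit_point \<sigma> p t =
     (\<lambda>u\<in>weight_semigroup \<sigma>. if scalar_product p u = 0 then laurent_monomial u t else 0)"

lemma orbit_point_in_toric_variety:
  assumes "t \<in> torus" and "\<And>u. u \<in> weight_semigroup \<sigma> \<Longrightarrow> 0 \<le> scalar_product p u"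
  shows "orbit_point \<sigma> p t \<in> toric_variety \<sigma>"
  using assms(1) assms(2)
  by (auto simp: toric_variety_def orbit_point_def weight_semigroup_add laurent_monomial_add
      scalar_product_add_right add_nonneg_eq_0_iff)

lemma orbit_point_in_ray_orbit:
  assumes "t \<in> torus" and "\<And>u. u \<in> weight_semigroup \<sigma> \<Longrightarrow> 0 \<le> scalar_product p u"
  shows "orbit_point \<sigma> p t \<in> ray_orbit \<sigma> p"
  using orbit_point_in_toric_variety[OF assms] assms(1)
  by (auto simp: ray_orbit_def orbit_point_def laurent_monomial_nonzero)

text \<open>
  The principal open sets are closed under intersection because evaluation at a point is
  multiplicative on regular functions.
\<close>

lemma principal_open_inter:
  assumes "f \<in> regular_functions \<sigma>" "g \<in> regular_functions \<sigma>"
  shows "f * g \<in> regular_functions \<sigma>"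
    and "principal_open \<sigma> (f * g) = principal_open \<sigma> f \<inter> principal_open \<sigma> g"
proof -
  show "f * g \<in> regular_functions \<sigma>"
    using keys_mult[of f g] assms by (fastforce simp: regular_functions_def weight_semigroup_add)
  have "eval_at (f * g) x = eval_at f x * eval_at g x" if "x \<in> toric_variety \<sigma>" for x
    using assms that by (intro eval_at_mult) (auto simp: regular_functions_def toric_variety_def)
  then show "principal_open \<sigma> (f * g) = principal_open \<sigma> f \<inter> principal_open \<sigma> g"
    by (auto simp: principal_open_def)
qed

lemma zariski_open_contains_principal_open:
  assumes "openin (zariski_topology \<sigma>) U" "x \<in> U"
  shows "\<exists>f\<in>regular_functions \<sigma>. x \<in> principal_open \<sigma> f \<and> principal_open \<sigma> f \<subseteq> U"
proof -
  have "generate_topology_on (principal_open \<sigma> ` regular_functions \<sigma>) U"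
    using assms(1) unfolding zariski_topology_def by (rule openin_topology_generated_by)
  then show ?thesis using assms(2)
  proof (induction arbitrary: x rule: generate_topology_on.induct)
    case (Int U V)
    then obtain f g where "f \<in> regular_functions \<sigma>" "x \<in> principal_open \<sigma> f" "principal_open \<sigma> f \<subseteq> U"
      "g \<in> regular_functions \<sigma>" "x \<in> principal_open \<sigma> g" "principal_open \<sigma> g \<subseteq> V"
      by (metis IntE)
    then show ?case using principal_open_inter[of f \<sigma> g]
      by (intro bexI[of _ "f * g"]) auto
  next
    case (UN K)
    then obtain U where U: "U \<in> K" "x \<in> U" by blast
    with UN.IH show ?case by (meson Union_upper order_trans)
  qed auto
qed

lemma topspace_zariski_topology [simp]: "topspace (zariski_topology \<sigma>) = toric_variety \<sigma>"
proof -
  have "(1 :: int ^ 'a \<Rightarrow>\<^sub>0 'b) \<in> regular_functions \<sigma>"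
    by (simp add: regular_functions_def)
  moreover have "principal_open \<sigma> (1 :: int ^ 'a \<Rightarrow>\<^sub>0 'b) = toric_variety \<sigma>"
    by (auto simp: principal_open_def toric_variety_def eval_at_def)
  ultimately show ?thesis
    unfolding zariski_topology_def topology_generated_by_topspace
    by (auto simp: principal_open_def)
qed

text \<open>
  The right-hand side is closed, being the zero set of the \<open>\<chi>\<^sup>u\<close> with \<open>u\<close> not orthogonal to \<open>p\<close>.
  Conversely, at a point of it a regular function depends on its part supported on the exponents
  orthogonal to \<open>p\<close> only; if its value is nonzero, then so is this part, hence so is its value at some point
  of the orbit, because Laurent monomials are independent.
\<close>

lemma closure_of_ray_orbit:
  fixes \<sigma> :: "(rat ^ 'n) set"
  assumes nonneg: "\<And>u. u \<in> weight_semigroup \<sigma> \<Longrightarrow> 0 \<le> scalar_product p u"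
  shows "zariski_topology \<sigma> closure_of (ray_orbit \<sigma> p :: (int ^ 'n \<Rightarrow> 'k::field_char_0) set) =
    {x \<in> toric_variety \<sigma>. \<forall>u\<in>weight_semigroup \<sigma>. scalar_product p u \<noteq> 0 \<longrightarrow> x u = 0}"
    (is "_ = ?F")
proof (intro equalityI subsetI)
  fix x :: "int ^ 'n \<Rightarrow> 'k" assume x: "x \<in> zariski_topology \<sigma> closure_of ray_orbit \<sigma> p"
  then have X: "x \<in> toric_variety \<sigma>" by (simp add: in_closure_of)
  have "x u = 0" if u: "u \<in> weight_semigroup \<sigma>" "scalar_product p u \<noteq> 0" for u
  proof (rule ccontr)
    assume nz: "x u \<noteq> 0"
    let ?f = "Poly_Mapping.single u (1::'k)"
    have "?f \<in> regular_functions \<sigma>" using u by (simp add: regular_functions_def)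
    then have "openin (zariski_topology \<sigma>) (principal_open \<sigma> ?f)"
      unfolding zariski_topology_def by (blast intro: topology_generated_by_Basis)
    moreover have "x \<in> principal_open \<sigma> ?f" using X nz by (simp add: principal_open_def)
    ultimately obtain y where "y \<in> ray_orbit \<sigma> p" "y \<in> principal_open \<sigma> ?f"
      using x unfolding in_closure_of by blast
    then show False using u by (auto simp: ray_orbit_def principal_open_def)
  qed
  then show "x \<in> ?F" using X by blast
next
  fix x :: "int ^ 'n \<Rightarrow> 'k" assume x: "x \<in> ?F"
  show "x \<in> zariski_topology \<sigma> closure_of ray_orbit \<sigma> p"
    unfolding in_closure_of
  proof (intro conjI allI impI)
    show "x \<in> topspace (zariski_topology \<sigma>)" using x by simp
    fix U assume "x \<in> U \<and> openin (zariski_topology \<sigma>) U"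
    then obtain f where f: "f \<in> regular_functions \<sigma>" "x \<in> principal_open \<sigma> f" "principal_open \<sigma> f \<subseteq> U"
      using zariski_open_contains_principal_open by blast
    let ?A = "{m \<in> Poly_Mapping.keys f. scalar_product p m = 0}"
    have keys: "Poly_Mapping.keys f \<subseteq> weight_semigroup \<sigma>" using f(1) by (simp add: regular_functions_def)
    have eval_orbit_point: "eval_at f (orbit_point \<sigma> p t) =
        (\<Sum>m\<in>?A. Poly_Mapping.lookup f m * laurent_monomial m t)" for t
      unfolding eval_at_def
      by (rule sum.mono_neutral_cong_right) (use keys in \<open>auto simp: orbit_point_def\<close>)
    have "\<exists>t\<in>torus. eval_at f (orbit_point \<sigma> p t) \<noteq> 0"
    proof (rule ccontr)
      assume "\<not> ?thesis"
      then have "Poly_Mapping.lookup f m = 0" if "m \<in> ?A" for m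
        using laurent_monomials_independent[of ?A "Poly_Mapping.lookup f" m] that
        unfolding eval_orbit_point by auto
      then have "eval_at f x = 0"
        unfolding eval_at_def using x keys by (intro sum.neutral) auto
      then show False using f(2) by (simp add: principal_open_def)
    qed
    then obtain t where t: "t \<in> torus" "eval_at f (orbit_point \<sigma> p t) \<noteq> 0" by blast
    have "orbit_point \<sigma> p t \<in> U"
      using t f(3) orbit_point_in_toric_variety[OF t(1) nonneg] by (auto simp: principal_open_def)
    then show "\<exists>y. y \<in> ray_orbit \<sigma> p \<and> y \<in> U"
      using orbit_point_in_ray_orbit[OF t(1) nonneg] by blast
  qed
qed


section \<open>The center\<close>

lemma toric_mult_apply:
  fixes x y :: "int ^ 'n \<Rightarrow> 'k::field"
  assumes "u \<in> weight_semigroup \<sigma>" "scalar_product p u = int d"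
  shows "toric_mult \<sigma> p e\<^sub>1 e\<^sub>2 x y u =
    (\<Sum>i\<le>d. of_nat (d choose i) * x (u + int i *s e\<^sub>2) * y (u + int (d - i) *s e\<^sub>1))"
  using assms by (simp add: toric_mult_def eval_at_comult)

lemma toric_mult_commute_equal_roots:
  fixes x y :: "int ^ 'n \<Rightarrow> 'k::field"
  shows "toric_mult \<sigma> p e e x y = toric_mult \<sigma> p e e y x"
  unfolding toric_mult_def eval_at_comult
proof (rule restrict_ext)
  fix u
  let ?d = "nat (scalar_product p u)"
  show "(\<Sum>i\<le>?d. of_nat (?d choose i) * x (u + int i *s e) * y (u + int (?d - i) *s e)) =
    (\<Sum>i\<le>?d. of_nat (?d choose i) * y (u + int i *s e) * x (u + int (?d - i) *s e))"
    by (rule sum.reindex_bij_witness[of _ "\<lambda>i. ?d - i" "\<lambda>i. ?d - i"])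
      (auto simp: binomial_symmetric[symmetric])
qed

text \<open>
  Multiplication by a point \<open>t\<close> of the open orbit, where \<open>\<chi>\<^sup>u\<close> is the Laurent monomial, turns
  \<open>x * t = t * x\<close> into a relation between Laurent monomials whose exponents are \<open>u + j e\<^sub>1\<close> (on the
  left) and \<open>u + i e\<^sub>2\<close> (on the right).  The exponent \<open>u + d e\<^sub>1\<close> with \<open>d = \<langle>p, u\<rangle>\<close> occurs only once, with
  coefficient \<open>\<chi>\<^sup>u(x)\<close>: its pairing with \<open>p\<close> is \<open>0\<close>, and the only other exponent of this kind is
  \<open>u + d e\<^sub>2\<close>.
\<close>

lemma commuting_with_torus_imp_zero:
  fixes x :: "int ^ 'n \<Rightarrow> 'k::field_char_0"
  assumes \<sigma>: "strongly_convex_polyhedral_cone \<sigma>"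
    and roots: "demazure_root \<sigma> p e\<^sub>1" "demazure_root \<sigma> p e\<^sub>2" and ne: "e\<^sub>1 \<noteq> e\<^sub>2"
    and u: "u \<in> weight_semigroup \<sigma>" "scalar_product p u = int d" "0 < d"
    and commute: "\<And>t. t \<in> torus \<Longrightarrow>
      toric_mult \<sigma> p e\<^sub>1 e\<^sub>2 x (orbit_point \<sigma> 0 t) u = toric_mult \<sigma> p e\<^sub>1 e\<^sub>2 (orbit_point \<sigma> 0 t) x u"
  shows "x u = 0"
proof -
  note pairing = roots[THEN scalar_product_add_demazure_root]
  define c where "c = case_sum
    (\<lambda>i. of_nat (d choose i) * x (u + int i *s e\<^sub>2))
    (\<lambda>i. - of_nat (d choose i) * x (u + int (d - i) *s e\<^sub>1))"
  define m where "m = case_sum (\<lambda>i. u + int (d - i) *s e\<^sub>1) (\<lambda>i. u + int i *s e\<^sub>2)"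
  show ?thesis
  proof (rule laurent_monomial_isolated_coefficient)
    show "finite ({1..d} <+> {..d})" by simp
  next
    fix k assume k: "k \<in> {1..d} <+> {..d}"
    show "m k \<noteq> u + int d *s e\<^sub>1"
    proof
      assume eq: "m k = u + int d *s e\<^sub>1"
      then have pairing_zero: "scalar_product p (m k) = 0" using u(2) by (simp add: pairing)
      from k show False
      proof (elim PlusE)
        fix i assume i: "i \<in> {1..d}" "k = Inl i"
        then have "d = d - i" using pairing_zero u(2) by (simp add: m_def pairing del: of_nat_diff)
        then show False using i by auto
      next
        fix i assume i: "i \<in> {..d}" "k = Inr i"
        then have "i = d" using pairing_zero u(2) by (simp add: m_def pairing)
        then have "int d *s e\<^sub>2 = int d *s e\<^sub>1" using eq i by (simp add: m_def)
        then show False using ne u(3) by (simp add: vec_eq_iff)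
      qed
    qed
  next
    fix t :: "'k ^ 'n" assume t: "t \<in> torus"
    have mem1: "u + int i *s e\<^sub>1 \<in> weight_semigroup \<sigma>" if "i \<le> d" for i
      using weight_semigroup_add_demazure_roots[OF \<sigma> roots u(1), of i 0] that u(2) by simp
    have mem2: "u + int i *s e\<^sub>2 \<in> weight_semigroup \<sigma>" if "i \<le> d" for i
      using weight_semigroup_add_demazure_roots[OF \<sigma> roots u(1), of 0 i] that u(2) by simp
    have left: "toric_mult \<sigma> p e\<^sub>1 e\<^sub>2 x (orbit_point \<sigma> 0 t) u =
        (\<Sum>i\<le>d. c (Inl i) * laurent_monomial (m (Inl i)) t)"
      unfolding toric_mult_apply[OF u(1,2)]
      by (rule sum.cong) (simp_all add: c_def m_def orbit_point_def mem1 del: of_nat_diff)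
    have right: "toric_mult \<sigma> p e\<^sub>1 e\<^sub>2 (orbit_point \<sigma> 0 t) x u =
        - (\<Sum>i\<le>d. c (Inr i) * laurent_monomial (m (Inr i)) t)"
      unfolding toric_mult_apply[OF u(1,2)] sum_negf[symmetric]
      by (rule sum.cong) (simp_all add: c_def m_def orbit_point_def mem2 del: of_nat_diff)
    have "(\<Sum>i\<le>d. c (Inl i) * laurent_monomial (m (Inl i)) t) =
        x u * laurent_monomial (u + int d *s e\<^sub>1) t +
        (\<Sum>i=1..d. c (Inl i) * laurent_monomial (m (Inl i)) t)"
    proof -
      have "{..d} = insert 0 {1..d}" by auto
      then show ?thesis by (simp add: c_def m_def)
    qed
    then have "x u * laurent_monomial (u + int d *s e\<^sub>1) t +
        (\<Sum>i=1..d. c (Inl i) * laurent_monomial (m (Inl i)) t) =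
        - (\<Sum>i\<le>d. c (Inr i) * laurent_monomial (m (Inr i)) t)"
      using commute[OF t] unfolding left right by (rule subst)
    then show "x u * laurent_monomial (u + int d *s e\<^sub>1) t +
        (\<Sum>k\<in>{1..d} <+> {..d}. c k * laurent_monomial (m k) t) = 0"
      unfolding eq_neg_iff_add_eq_0 by (simp add: sum.Plus add.assoc)
  qed
qed

text \<open>
  Exchanging the \<open>d\<close> summands \<open>e\<^sub>1\<close> for \<open>e\<^sub>2\<close> one at a time: each step is the hypothesis for an
  exponent \<open>u + i e\<^sub>1 + j e\<^sub>2\<close> with \<open>i + j = d - 1\<close>, whose pairing with \<open>p\<close> is one.
\<close>

lemma exchange_roots:
  assumes \<sigma>: "strongly_convex_polyhedral_cone \<sigma>"
    and roots: "demazure_root \<sigma> p e\<^sub>1" "demazure_root \<sigma> p e\<^sub>2"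
    and eq: "\<And>w. w \<in> weight_semigroup \<sigma> \<Longrightarrow> scalar_product p w = 1 \<Longrightarrow> x (w + e\<^sub>1) = x (w + e\<^sub>2)"
    and u: "u \<in> weight_semigroup \<sigma>" "scalar_product p u = int d"
  shows "x (u + int d *s e\<^sub>1) = x (u + int d *s e\<^sub>2)"
proof -
  have "x (u + int (d - j) *s e\<^sub>1 + int j *s e\<^sub>2) = x (u + int d *s e\<^sub>1)" if "j \<le> d" for j
    using that
  proof (induction j)
    case (Suc j)
    let ?w = "u + int (d - Suc j) *s e\<^sub>1 + int j *s e\<^sub>2"
    have "?w \<in> weight_semigroup \<sigma>"
      by (rule weight_semigroup_add_demazure_roots[OF \<sigma> roots u(1)]) (use Suc u in auto)
    moreover have "scalar_product p ?w = 1"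
      unfolding roots[THEN scalar_product_add_demazure_root] using Suc.prems u by simp
    ultimately have "x (?w + e\<^sub>1) = x (?w + e\<^sub>2)" by (rule eq)
    moreover have "?w + e\<^sub>1 = u + int (d - j) *s e\<^sub>1 + int j *s e\<^sub>2"
      using Suc.prems by (simp add: vec_eq_iff algebra_simps)
    moreover have "?w + e\<^sub>2 = u + int (d - Suc j) *s e\<^sub>1 + int (Suc j) *s e\<^sub>2"
      by (simp add: vec_eq_iff algebra_simps)
    ultimately show ?case using Suc by (metis Suc_leD)
  qed simp
  from this[of d] show ?thesis by simp
qed

theorem proposition5:
  fixes \<sigma> \<rho> :: "(rat ^ 'n) set"
    and p e\<^sub>1 e\<^sub>2 :: "int ^ 'n"
    and X :: "(int ^ 'n \<Rightarrow> 'k :: {alg_closed_field, field_char_0}) set"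
  assumes "strongly_convex_polyhedral_cone \<sigma>"
    and "ray_of_cone \<rho> \<sigma>"
    and "primitive_vector_on p \<rho>"
    and "demazure_root \<sigma> p e\<^sub>1"
    and "demazure_root \<sigma> p e\<^sub>2"
    and "X = toric_variety \<sigma>"
  shows "center X (toric_mult \<sigma> p e\<^sub>1 e\<^sub>2) =
    (if e\<^sub>1 \<noteq> e\<^sub>2
     then (zariski_topology \<sigma> closure_of ray_orbit \<sigma> p) \<inter>
       {x \<in> X. \<forall>u\<in>weight_semigroup \<sigma>. scalar_product p u = 1 \<longrightarrow> x (u + e\<^sub>1) = x (u + e\<^sub>2)}
     else X)"
proof (cases "e\<^sub>1 = e\<^sub>2")
  case True
  then show ?thesis using toric_mult_commute_equal_roots by (auto simp: center_def)
next
  case False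
  note \<sigma> = assms(1) and roots = assms(4,5)
  have "p \<in> ray_generators \<sigma>" using assms by (auto simp: ray_generators_def)
  then have nonneg: "0 \<le> scalar_product p u" if "u \<in> weight_semigroup \<sigma>" for u
    using that weight_semigroup_iff_ray_generators[OF \<sigma>] by blast
  have pairing_nat: "\<exists>d. scalar_product p u = int d" if "u \<in> weight_semigroup \<sigma>" for u
    using nonneg[OF that] nonneg_int_cases by metis
  let ?Z = "{x \<in> toric_variety \<sigma>. (\<forall>u\<in>weight_semigroup \<sigma>. scalar_product p u \<noteq> 0 \<longrightarrow> x u = (0::'k)) \<and>
    (\<forall>u\<in>weight_semigroup \<sigma>. scalar_product p u = 1 \<longrightarrow> x (u + e\<^sub>1) = x (u + e\<^sub>2))}"
  have "center X (toric_mult \<sigma> p e\<^sub>1 e\<^sub>2) = ?Z"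
  proof (intro equalityI subsetI)
    fix x assume x: "x \<in> center X (toric_mult \<sigma> p e\<^sub>1 e\<^sub>2)"
    have commute: "toric_mult \<sigma> p e\<^sub>1 e\<^sub>2 x (orbit_point \<sigma> 0 t) = toric_mult \<sigma> p e\<^sub>1 e\<^sub>2 (orbit_point \<sigma> 0 t) x"
      if "t \<in> torus" for t
      using x assms(6) orbit_point_in_toric_variety[OF that, of \<sigma> 0] by (auto simp: center_def)
    have "x u = 0" if u: "u \<in> weight_semigroup \<sigma>" "scalar_product p u \<noteq> 0" for u
    proof -
      obtain d where d: "scalar_product p u = int d" using pairing_nat u by blast
      show ?thesis
        by (rule commuting_with_torus_imp_zero[OF \<sigma> roots False u(1) d]) (use d u commute in auto)
    qed
    moreover have "x (u + e\<^sub>1) = x (u + e\<^sub>2)" if u: "u \<in> weight_semigroup \<sigma>" "scalar_product p u = 1" for u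
    proof -
      have mem: "u + e\<^sub>1 \<in> weight_semigroup \<sigma>" "u + e\<^sub>2 \<in> weight_semigroup \<sigma>"
        using weight_semigroup_add_demazure_roots[OF \<sigma> roots u(1), of 1 0]
          weight_semigroup_add_demazure_roots[OF \<sigma> roots u(1), of 0 1] u(2) by auto
      have d: "scalar_product p u = int 1" using u by simp
      \<comment> \<open>at the unit of the torus, where all the monomials are one\<close>
      show ?thesis
        using fun_cong[OF commute[OF one_in_torus], of u] u(1) mem
        unfolding toric_mult_apply[OF u(1) d]
        by (simp add: orbit_point_def)
    qed
    ultimately show "x \<in> ?Z" using x assms(6) by (simp add: center_def)
  next
    fix x assume x: "x \<in> ?Z"
    have "toric_mult \<sigma> p e\<^sub>1 e\<^sub>2 x y = toric_mult \<sigma> p e\<^sub>1 e\<^sub>2 y x" for y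
    proof
      fix u
      show "toric_mult \<sigma> p e\<^sub>1 e\<^sub>2 x y u = toric_mult \<sigma> p e\<^sub>1 e\<^sub>2 y x u"
      proof (cases "u \<in> weight_semigroup \<sigma>")
        case u: True
        then obtain d where d: "scalar_product p u = int d" using pairing_nat by blast
        have vanish1: "x (u + int i *s e\<^sub>1) = 0" if "i < d" for i
        proof -
          have "u + int i *s e\<^sub>1 \<in> weight_semigroup \<sigma>"
            using weight_semigroup_add_demazure_roots[OF \<sigma> roots u, of i 0] that d by simp
          moreover have "scalar_product p (u + int i *s e\<^sub>1) \<noteq> 0"
            using that d by (simp add: roots[THEN scalar_product_add_demazure_root])
          ultimately show ?thesis using x by blast
        qed
        have vanish2: "x (u + int i *s e\<^sub>2) = 0" if "i < d" for i
        proof -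
          have "u + int i *s e\<^sub>2 \<in> weight_semigroup \<sigma>"
            using weight_semigroup_add_demazure_roots[OF \<sigma> roots u, of 0 i] that d by simp
          moreover have "scalar_product p (u + int i *s e\<^sub>2) \<noteq> 0"
            using that d by (simp add: roots[THEN scalar_product_add_demazure_root])
          ultimately show ?thesis using x by blast
        qed
        \<comment> \<open>only one term of each product survives\<close>
        have "toric_mult \<sigma> p e\<^sub>1 e\<^sub>2 x y u = (\<Sum>i\<in>{d}. x (u + int i *s e\<^sub>2) * y (u + int (d - i) *s e\<^sub>1))"
          unfolding toric_mult_apply[OF u d]
          by (rule sum.mono_neutral_cong_right) (auto simp: vanish2)
        moreover have "toric_mult \<sigma> p e\<^sub>1 e\<^sub>2 y x u = (\<Sum>i\<in>{0}. y (u + int i *s e\<^sub>2) * x (u + int (d - i) *s e\<^sub>1))"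
          unfolding toric_mult_apply[OF u d]
          by (rule sum.mono_neutral_cong_right) (auto simp: vanish1 simp del: of_nat_diff)
        moreover have "x (u + int d *s e\<^sub>1) = x (u + int d *s e\<^sub>2)"
          by (rule exchange_roots[OF \<sigma> roots _ u d]) (use x in blast)
        ultimately show ?thesis by simp
      qed (simp add: toric_mult_def)
    qed
    then show "x \<in> center X (toric_mult \<sigma> p e\<^sub>1 e\<^sub>2)" using x assms(6) by (simp add: center_def)
  qed
  also have "?Z = (zariski_topology \<sigma> closure_of ray_orbit \<sigma> p) \<inter>
      {x \<in> X. \<forall>u\<in>weight_semigroup \<sigma>. scalar_product p u = 1 \<longrightarrow> x (u + e\<^sub>1) = x (u + e\<^sub>2)}"
    using nonneg by (auto simp: closure_of_ray_orbit assms(6))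
  finally show ?thesis using False by simp
qed

end
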